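(* Let $D\subseteq\mathbb R$ be open, $J:D\to\mathbb R$, $g_1,g_2:\mathbb R\to\mathbb R$, and $N\in\mathbb N$, $N\ge 1$, be such that $f_k:=g_k\circ J\in C^{N+1}(D;\mathbb R)$ for $k=1,2$. Let $\kappa\in\mathbb N$, $\kappa\ge 1$, and let $c_1,c_2\in\mathbb R$ satisfy $$c_1^N c_2=(4\pi\kappa)^N\,N!\,(-1)^{\lfloor N/2\rfloor}.$$ For $\varepsilon>0$ put $u_1^\varepsilon(t)=\varepsilon^{-\frac{N}{N+1}}c_1v_1^\varepsilon(t)$ and $u_2^\varepsilon(t)=\varepsilon^{-\frac{N}{N+1}}c_2v_2^\varepsilon(t)$, where $$v_1^\varepsilon(t)=\cos\Big(\frac{2\kappa\pi t}{\varepsilon}\Big),\qquad v_2^\varepsilon(t)=\begin{cases}\sin\Big(\dfrac{2N\kappa\pi t}{\varepsilon}\Big), & N\text{ odd},\\[2mm] \cos\Big(\dfrac{2N\kappa\pi t}{\varepsilon}\Big), & N \text{ even}.\end{cases}$$ Let $x^0\in D$ and let $x:[0,\varepsilon]\to D$ be a solution of $$\dot x=g_1(J(x))\,u_1^\varepsilon(t)+g_2(J(x))\,u_2^\varepsilon(t),\qquad x(0)=x^0.$$ Then $$x(\varepsilon)=x^0+\varepsilon\,\big(\mathrm{ad}_{f_1}^N f_2\big)(x^0)+R(\varepsilon),$$ where $R(\varepsilon)$ is the Chen--Fliess remainder $$R(\varepsilon)=\sum_{k_1,\dots,k_{N+2}=1}^{2}\int_0^\varepsilon\int_0^{s_1}\cdots\int_0^{s_{N+1}}\big(L_{f_{k_{N+2}}}\cdots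 L_{f_{k_2}}f_{k_1}\big)(x(s_{N+2}))\,u_{k_1}^\varepsilon(s_1)\cdots u_{k_{N+2}}^\varepsilon(s_{N+2})\,ds_{N+2}\cdots ds_1 .$$
   Context: For sufficiently smooth $f,g:D\to\mathbb R$ with $D\subseteq \mathbb R$ open (regarded as vector fields on $D$), the Lie derivative is $L_g f(x)=f'(x)g(x)$ and the Lie bracket is $[f,g](x)=L_f g(x)-L_g f(x)$. In $L_{f_{k_{\ell}}}\cdots L_{f_{k_2}}f_{k_1}$ the operator $L_{f_{k_2}}$ is applied first, to $f_{k_1}$, then $L_{f_{k_3}}$, and so on. The iterated bracket is $\mathrm{ad}_{f_1}^N f_2=[\underbrace{f_1,[f_1,\dots,[f_1}_{N\text{ times}},f_2]\dots]]$. $\lfloor\cdot\rfloor$ denotes the integer part. *)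

theory Defs
  imports "HOL-Analysis.Analysis"
begin

text \<open>Functions on an open set \<open>D\<close> are total functions considered on \<open>D\<close> only: since \<open>D\<close> is open,
  the values of \<^const>\<open>deriv\<close> at points of \<open>D\<close> do not depend on the extension.\<close>

definition Ck_on :: "nat \<Rightarrow> real set \<Rightarrow> (real \<Rightarrow> real) \<Rightarrow> bool" where
  "Ck_on n D f \<longleftrightarrow>
     (\<forall>j<n. \<forall>x\<in>D. (deriv ^^ j) f differentiable at x) \<and>
     (\<forall>j\<le>n. continuous_on D ((deriv ^^ j) f))"

definition lie_deriv :: "(real \<Rightarrow> real) \<Rightarrow> (real \<Rightarrow> real) \<Rightarrow> real \<Rightarrow> real" where
  "lie_deriv g f x = deriv f x * g x"

definition lie_bracket :: "(real \<Rightarrow> real) \<Rightarrow> (real \<Rightarrow> real) \<Rightarrow> real \<Rightarrow> real" where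
  "lie_bracket f g x = lie_deriv f g x - lie_deriv g f x"

definition ad_pow :: "nat \<Rightarrow> (real \<Rightarrow> real) \<Rightarrow> (real \<Rightarrow> real) \<Rightarrow> real \<Rightarrow> real" where
  "ad_pow n f g = (lie_bracket f ^^ n) g"

text \<open>For \<open>ks = [k\<^sub>1, \<dots>, k\<^sub>m]\<close>, starting from \<open>f k\<^sub>1\<close>, the operator of \<open>f k\<^sub>2\<close> is applied first and
  that of \<open>f k\<^sub>m\<close> last.\<close>

definition lie_word :: "(nat \<Rightarrow> real \<Rightarrow> real) \<Rightarrow> nat list \<Rightarrow> real \<Rightarrow> real" where
  "lie_word f ks = fold (\<lambda>k. lie_deriv (f k)) (tl ks) (f (hd ks))"

text \<open>\<open>nested_integral m F t\<close> is the integral of \<open>F [s\<^sub>1, \<dots>, s\<^sub>m]\<close> with respect to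
  \<open>ds\<^sub>m \<dots> ds\<^sub>1\<close>, where \<open>s\<^sub>1\<close> ranges over \<open>[0, t]\<close> and \<open>s\<^sub>i\<^sub>+\<^sub>1\<close> over \<open>[0, s\<^sub>i]\<close>.\<close>

primrec nested_integral :: "nat \<Rightarrow> (real list \<Rightarrow> real) \<Rightarrow> real \<Rightarrow> real" where
  "nested_integral 0 F t = F []"
| "nested_integral (Suc m) F t =
     integral {0..t} (\<lambda>s. nested_integral m (\<lambda>ss. F (s # ss)) s)"

text \<open>The two vector fields and the two inputs are indexed by \<open>1\<close> and \<open>2\<close>; list positions
  count from \<open>0\<close>.\<close>

definition chen_fliess_remainder ::
    "nat \<Rightarrow> (nat \<Rightarrow> real \<Rightarrow> real) \<Rightarrow> (nat \<Rightarrow> real \<Rightarrow> real) \<Rightarrow> (real \<Rightarrow> real) \<Rightarrow> real \<Rightarrow> real" where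
  "chen_fliess_remainder N f u x \<epsilon> =
     (\<Sum>ks | set ks \<subseteq> {1, 2} \<and> length ks = N + 2.
        nested_integral (N + 2)
          (\<lambda>ss. lie_word f ks (x (ss ! (N + 1))) * (\<Prod>i<N + 2. u (ks ! i) (ss ! i))) \<epsilon>)"

definition dither :: "nat \<Rightarrow> nat \<Rightarrow> real \<Rightarrow> nat \<Rightarrow> real \<Rightarrow> real" where
  "dither N \<kappa> \<epsilon> k t =
     (if k = 1 then cos (2 * real \<kappa> * pi * t / \<epsilon>)
      else if odd N then sin (2 * real N * real \<kappa> * pi * t / \<epsilon>)
      else cos (2 * real N * real \<kappa> * pi * t / \<epsilon>))"

definition control :: "nat \<Rightarrow> nat \<Rightarrow> (nat \<Rightarrow> real) \<Rightarrow> real \<Rightarrow> nat \<Rightarrow> real \<Rightarrow> real" where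
  "control N \<kappa> c \<epsilon> k t = \<epsilon> powr (- (real N / real (N + 1))) * c k * dither N \<kappa> \<epsilon> k t"

end

theory Submission
  imports Defs
begin

text \<open>
  The Chen--Fliess expansion writes \<open>x \<epsilon>\<close> as a sum over words in the letters \<open>1, 2\<close> of Lie derivatives at
  \<open>x0\<close> times iterated integrals of the inputs. With \<open>\<theta> = \<omega> t\<close>, both inputs are multiples of functions
  \<open>cos (n \<theta> - d \<pi> / 2)\<close>, namely with \<open>(n, d) = (1, 0)\<close> and, up to a sign, \<open>(n, d) = (N, N)\<close>. The iterated
  integral over a word with \<open>p\<close> letters \<open>1\<close> and \<open>q\<close> letters \<open>2\<close> is a combination of such cosines
  with \<open>n = j + N l\<close>, \<open>\<bar>j\<bar> \<le> p\<close>, \<open>\<bar>l\<bar> \<le> q\<close> and \<open>d \<equiv> n + l\<close> modulo 2. The parity condition excludes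
  resonances unless \<open>p \<ge> N\<close> and \<open>q \<ge> 1\<close>, so the integral is periodic and vanishes at \<open>\<epsilon>\<close>.
  Among the nonempty words of length at most \<open>N + 1\<close> only the words \<open>1\<^sup>a 2 1\<^sup>b\<close> with \<open>a + b = N\<close> survive.
  As the primitive of the first input vanishes at \<open>\<epsilon>\<close>, their integrals are the alternating binomial
  coefficients times a common factor, and these are the coefficients of the words in the iterated bracket.
\<close>

subsection \<open>Functions of class \<open>C\<^sup>n\<close> and Lie derivatives\<close>

lemma Ck_on_0: "Ck_on 0 D f \<longleftrightarrow> continuous_on D f"
  by (simp add: Ck_on_def)

text \<open>Peeling off the innermost derivative makes the class recursive in the order; the closure
  properties below are proved by induction through this form.\<close>

lemma Ck_on_Suc:
  "Ck_on (Suc n) D f \<longleftrightarrow>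
     (\<forall>x\<in>D. f differentiable at x) \<and> continuous_on D f \<and> Ck_on n D (deriv f)"
proof -
  have *: "(deriv ^^ Suc j) f = (deriv ^^ j) (deriv f)" for j
    by (simp add: funpow_swap1)
  have "(\<forall>j\<le>Suc n. continuous_on D ((deriv ^^ j) f)) \<longleftrightarrow>
        continuous_on D f \<and> (\<forall>j\<le>n. continuous_on D ((deriv ^^ j) (deriv f)))"
    unfolding less_Suc_eq_le[symmetric] All_less_Suc2 * by simp
  moreover have "(\<forall>j<Suc n. \<forall>x\<in>D. (deriv ^^ j) f differentiable at x) \<longleftrightarrow>
        (\<forall>x\<in>D. f differentiable at x) \<and> (\<forall>j<n. \<forall>x\<in>D. (deriv ^^ j) (deriv f) differentiable at x)"
    unfolding All_less_Suc2 * by simp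
  ultimately show ?thesis
    unfolding Ck_on_def by blast
qed

lemma Ck_on_imp_continuous_on: "Ck_on n D f \<Longrightarrow> continuous_on D f"
  by (cases n) (simp_all add: Ck_on_0 Ck_on_Suc)

lemma Ck_on_SucD: "Ck_on (Suc n) D f \<Longrightarrow> Ck_on n D f"
  by (induction n arbitrary: f) (simp_all add: Ck_on_0 Ck_on_Suc)

lemma Ck_on_antimono:
  assumes "Ck_on n D f" and "m \<le> n"
  shows "Ck_on m D f"
  using assms(2,1) by (induction rule: dec_induct) (auto dest: Ck_on_SucD)

lemma Ck_on_imp_DERIV:
  assumes "Ck_on n D f" and "n > 0" and "x \<in> D"
  shows "(f has_real_derivative deriv f x) (at x)"
  using assms by (cases n) (auto simp: Ck_on_Suc DERIV_deriv_iff_real_differentiable)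

lemma deriv_eq_on_open:
  assumes "open D" and "\<And>x. x \<in> D \<Longrightarrow> f x = g x" and "x \<in> D"
  shows "deriv f x = deriv g x"
  using assms by (intro deriv_cong_ev eventually_mono[OF eventually_nhds_in_open]) auto

text \<open>The rules for \<open>deriv\<close> of a difference or a product are available at points
  of \<open>D\<close> only, so a function has to be replaced by one that agrees with it on
  \<open>D\<close>. As \<open>D\<close> is open, this leaves the derivatives on \<open>D\<close>
  unchanged.\<close>

lemma Ck_on_cong:
  assumes "open D" and "\<And>x. x \<in> D \<Longrightarrow> f x = g x" and "Ck_on n D f"
  shows "Ck_on n D g"
  using assms(2,3)
proof (induction n arbitrary: f g)
  case 0
  then show ?case
    using continuous_on_cong[OF refl, of D f g] by (simp add: Ck_on_0)
next
  case (Suc n)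
  have "g differentiable at x" if "x \<in> D" for x
  proof -
    have "eventually (\<lambda>x. f x = g x) (nhds x)"
      using Suc.prems(1) assms(1) that by (auto intro: eventually_mono[OF eventually_nhds_in_open])
    moreover have "(f has_real_derivative deriv f x) (at x)"
      using Suc.prems(2) that by (auto intro: Ck_on_imp_DERIV)
    ultimately have "(g has_real_derivative deriv f x) (at x)"
      using DERIV_cong_ev by blast
    then show ?thesis
      using real_differentiable_def by blast
  qed
  moreover have "continuous_on D g"
    using Suc.prems continuous_on_cong[OF refl, of D f g] by (simp add: Ck_on_Suc)
  moreover have "Ck_on n D (deriv g)"
    using Suc.prems by (intro Suc.IH[of "deriv f" "deriv g"])
      (auto simp: Ck_on_Suc intro: deriv_eq_on_open[OF assms(1)])
  ultimately show ?case
    by (simp add: Ck_on_Suc)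
qed

lemma Ck_on_const: "Ck_on n D (\<lambda>_. c)"
  by (induction n arbitrary: c) (simp_all add: Ck_on_0 Ck_on_Suc)

lemma Ck_on_ident: "Ck_on n D (\<lambda>x. x)"
  by (cases n) (simp_all add: Ck_on_0 Ck_on_Suc Ck_on_const)

lemma Ck_on_diff:
  assumes "open D" and "Ck_on n D f" and "Ck_on n D g"
  shows "Ck_on n D (\<lambda>x. f x - g x)"
  using assms(2,3)
proof (induction n arbitrary: f g)
  case 0
  then show ?case by (simp add: Ck_on_0 continuous_on_diff)
next
  case (Suc n)
  have "deriv (\<lambda>x. f x - g x) x = deriv f x - deriv g x" if "x \<in> D" for x
    using Suc.prems that by (intro DERIV_imp_deriv DERIV_diff) (auto intro: Ck_on_imp_DERIV)
  moreover have "Ck_on n D (\<lambda>x. deriv f x - deriv g x)"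
    using Suc.prems by (intro Suc.IH) (auto simp: Ck_on_Suc)
  ultimately have "Ck_on n D (deriv (\<lambda>x. f x - g x))"
    using Ck_on_cong[OF assms(1), of "\<lambda>x. deriv f x - deriv g x"] by simp
  then show ?case
    using Suc.prems by (auto simp: Ck_on_Suc intro!: continuous_on_diff)
qed

lemma Ck_on_add:
  assumes "open D" and "Ck_on n D f" and "Ck_on n D g"
  shows "Ck_on n D (\<lambda>x. f x + g x)"
  using Ck_on_diff[OF assms(1,2) Ck_on_diff[OF assms(1) Ck_on_const[of n D 0] assms(3)]] by simp

lemma Ck_on_mult:
  assumes "open D" and "Ck_on n D f" and "Ck_on n D g"
  shows "Ck_on n D (\<lambda>x. f x * g x)"
  using assms(2,3)
proof (induction n arbitrary: f g)
  case 0
  then show ?case by (simp add: Ck_on_0 continuous_on_mult)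
next
  case (Suc n)
  have "deriv (\<lambda>x. f x * g x) x = deriv f x * g x + deriv g x * f x" if "x \<in> D" for x
    using Suc.prems that by (intro DERIV_imp_deriv DERIV_mult) (auto intro: Ck_on_imp_DERIV)
  moreover have "Ck_on n D (\<lambda>x. deriv f x * g x + deriv g x * f x)"
    using Suc.prems
    by (intro Ck_on_add[OF assms(1)] Suc.IH) (auto simp: Ck_on_Suc intro: Ck_on_SucD)
  ultimately have "Ck_on n D (deriv (\<lambda>x. f x * g x))"
    using Ck_on_cong[OF assms(1), of "\<lambda>x. deriv f x * g x + deriv g x * f x"] by simp
  then show ?case
    using Suc.prems by (auto simp: Ck_on_Suc intro!: continuous_on_mult)
qed

section \<open>Lie derivatives, words and iterated brackets\<close>

lemma Ck_on_lie_deriv: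
  assumes "open D" and "Ck_on n D g" and "Ck_on (Suc n) D f"
  shows "Ck_on n D (lie_deriv g f)"
  using Ck_on_mult[OF assms(1) _ assms(2), of "deriv f"] assms(3)
  by (simp add: lie_deriv_def[abs_def] Ck_on_Suc)

lemma Ck_on_lie_bracket:
  assumes "open D" and "Ck_on (Suc n) D f" and "Ck_on (Suc n) D g"
  shows "Ck_on n D (lie_bracket f g)"
  unfolding lie_bracket_def[abs_def]
  using assms by (intro Ck_on_diff Ck_on_lie_deriv) (auto intro: Ck_on_SucD)

text \<open>Each bracket costs one derivative. The final order \<open>m\<close> stays arbitrary
  because the induction step needs the shorter iterate at order \<open>Suc m\<close>.\<close>

lemma Ck_on_ad_pow:
  assumes "open D" and "Ck_on (n + m) D f" and "Ck_on (n + m) D g"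
  shows "Ck_on m D (ad_pow n f g)"
  using assms(2,3)
proof (induction n arbitrary: m)
  case 0
  then show ?case by (simp add: ad_pow_def)
next
  case (Suc n)
  have "Ck_on (Suc m) D (ad_pow n f g)"
    using Suc by simp
  moreover have "Ck_on (Suc m) D f"
    using Suc.prems(1) by (rule Ck_on_antimono) simp
  ultimately have "Ck_on m D (lie_bracket f (ad_pow n f g))"
    by (intro Ck_on_lie_bracket assms(1))
  then show ?case
    by (simp add: ad_pow_def)
qed

text \<open>Unlike in \<open>lie_word\<close>, the start function is free: inductions can absorb the
  first letter into it, and the empty word is meaningful, which provides the zeroth term of the
  expansion.\<close>

definition lie_fold :: "('i \<Rightarrow> real \<Rightarrow> real) \<Rightarrow> 'i list \<Rightarrow> (real \<Rightarrow> real) \<Rightarrow> real \<Rightarrow> real" where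
  "lie_fold f ks = fold (\<lambda>k. lie_deriv (f k)) ks"

lemma lie_fold_Nil [simp]: "lie_fold f [] h = h"
  by (simp add: lie_fold_def)

lemma lie_fold_Cons [simp]: "lie_fold f (k # ks) h = lie_fold f ks (lie_deriv (f k) h)"
  by (simp add: lie_fold_def)

lemma lie_fold_snoc: "lie_fold f (ks @ [k]) h = lie_deriv (f k) (lie_fold f ks h)"
  by (simp add: lie_fold_def)

text \<open>The Lie derivative of the identity along \<open>g\<close> is \<open>g\<close>, so
  applying all letters to the identity amounts to starting from the first vector field.\<close>

lemma lie_word_eq_lie_fold:
  assumes "ks \<noteq> []"
  shows "lie_word f ks = lie_fold f ks (\<lambda>x. x)"
proof -
  have "lie_deriv g (\<lambda>x. x) = g" for g
    by (simp add: lie_deriv_def fun_eq_iff)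
  with assms show ?thesis
    by (cases ks) (simp_all add: lie_word_def lie_fold_def)
qed

text \<open>The field of a letter is itself differentiated by the later letters. The strictest
  demand concerns the first letter, whose field is needed with order one less than that of
  \<open>h\<close>; hence \<open>Suc m\<close>.\<close>

lemma Ck_on_lie_fold:
  assumes "open D" and "\<And>k. k \<in> set ks \<Longrightarrow> Ck_on m D (f k)"
    and "Ck_on (length ks + n) D h" and "length ks + n \<le> Suc m"
  shows "Ck_on n D (lie_fold f ks h)"
  using assms(2-4)
proof (induction ks arbitrary: h)
  case (Cons k ks)
  have "Ck_on (length ks + n) D (lie_deriv (f k) h)"
  proof (rule Ck_on_lie_deriv[OF assms(1)])
    show "Ck_on (length ks + n) D (f k)"
      by (rule Ck_on_antimono[OF Cons.prems(1)]) (use Cons.prems in auto)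
  qed (use Cons.prems in auto)
  then show ?case
    using Cons by simp
qed simp

text \<open>Pascal's rule splits the sum into the contributions of two maps: one keeps the index of
  \<open>T\<close>, the other raises it and brings a minus sign.\<close>

lemma sum_choose_Suc_alternating:
  fixes T :: "nat \<Rightarrow> 'a::comm_ring_1"
  shows "(\<Sum>a\<le>Suc n. (-1) ^ a * of_nat (Suc n choose a) * T a) =
    (\<Sum>a\<le>n. (-1) ^ a * of_nat (n choose a) * T a) - (\<Sum>a\<le>n. (-1) ^ a * of_nat (n choose a) * T (Suc a))"
proof -
  have "(\<Sum>a\<le>Suc n. (-1) ^ a * of_nat (Suc n choose a) * T a) =
      T 0 + (\<Sum>a\<le>n. (-1) ^ Suc a * of_nat (n choose Suc a) * T (Suc a))
      - (\<Sum>a\<le>n. (-1) ^ a * of_nat (n choose a) * T (Suc a))"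
    by (subst sum.atMost_Suc_shift) (simp add: algebra_simps sum.distrib sum_negf sum_subtractf)
  also have "T 0 + (\<Sum>a\<le>n. (-1) ^ Suc a * of_nat (n choose Suc a) * T (Suc a)) =
      (\<Sum>a\<le>Suc n. (-1) ^ a * of_nat (n choose a) * T a)"
    by (subst sum.atMost_Suc_shift) simp
  also have "\<dots> = (\<Sum>a\<le>n. (-1) ^ a * of_nat (n choose a) * T a)"
    by (simp add: binomial_eq_0)
  finally show ?thesis .
qed

text \<open>Both iterated Lie derivatives contain \<open>deriv (deriv h) x * f x * A x\<close>. It
  cancels in the difference, and the bracket remains as the factor of
  \<open>deriv h x\<close>.\<close>

lemma lie_deriv_lie_bracket:
  assumes "open D" and f: "Ck_on 1 D f" and A: "Ck_on 1 D A" and h: "Ck_on 2 D h" and "x \<in> D"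
  shows "lie_deriv (lie_bracket f A) h x
    = lie_deriv f (lie_deriv A h) x - lie_deriv A (lie_deriv f h) x"
proof -
  have h': "Ck_on 1 D (deriv h)"
    using h by (simp add: numeral_2_eq_2 Ck_on_Suc)
  note D = Ck_on_imp_DERIV[OF _ _ \<open>x \<in> D\<close>]
  have "deriv (lie_deriv F h) x = deriv (deriv h) x * F x + deriv F x * deriv h x"
    if "Ck_on 1 D F" for F
    unfolding lie_deriv_def[abs_def]
    by (intro DERIV_imp_deriv DERIV_mult D[OF h'] D[OF that]) simp_all
  from this[OF f] this[OF A] show ?thesis
    by (simp add: lie_deriv_def lie_bracket_def algebra_simps)
qed

text \<open>The bracket is the commutator of the operators, so \<open>ad\<close> is the difference of the commuting maps
  of left and right multiplication by \<open>L\<^sub>f\<close>; this is their binomial expansion.\<close>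

lemma ad_pow_expansion:
  assumes "open D" and f: "Ck_on (Suc m) D (f i)" "Ck_on (Suc m) D (f j)"
    and "n \<le> m" and "Ck_on (Suc n) D h" and "x \<in> D"
  shows "lie_deriv (ad_pow n (f i) (f j)) h x
    = (\<Sum>a\<le>n. (-1) ^ a * real (n choose a) *
         lie_fold f (replicate a i @ j # replicate (n - a) i) h x)"
  using assms(4-6)
proof (induction n arbitrary: h x)
  case 0
  then show ?case by (simp add: ad_pow_def)
next
  case (Suc n)
  define W where "W n a = replicate a i @ j # replicate (n - a) i" for n a
  let ?A = "ad_pow n (f i) (f j)"
  have A: "Ck_on 1 D ?A"
    using Suc.prems(1)
    by (intro Ck_on_ad_pow assms(1) Ck_on_antimono[OF f(1)] Ck_on_antimono[OF f(2)]) simp_all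
  have fi: "Ck_on (Suc n) D (f i)"
    using Suc.prems(1) by (intro Ck_on_antimono[OF f(1)]) simp
  have h1: "Ck_on (Suc n) D (lie_deriv (f i) h)"
    by (intro Ck_on_lie_deriv assms(1) fi Suc.prems)
  have C: "Ck_on 1 D (lie_fold f (W n a) h)" if "a \<le> n" for a
  proof (rule Ck_on_lie_fold[OF assms(1)])
    fix k assume "k \<in> set (W n a)"
    then have "k = i \<or> k = j" by (auto simp: W_def)
    then show "Ck_on (Suc m) D (f k)" using f by blast
  next
    show "Ck_on (length (W n a) + 1) D h" "length (W n a) + 1 \<le> Suc (Suc m)"
      using that Suc.prems(1,2) by (simp_all add: W_def)
  qed
  \<comment> \<open>Left multiplication appends \<open>i\<close> to each word. The induction
    hypothesis holds on all of the open set \<open>D\<close>, so it may be differentiated term by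
    term.\<close>
  have left: "lie_deriv (f i) (lie_deriv ?A h) x =
      (\<Sum>a\<le>n. (-1) ^ a * real (n choose a) * lie_fold f (W (Suc n) a) h x)"
  proof -
    have "deriv (lie_deriv ?A h) x =
        deriv (\<lambda>x. \<Sum>a\<le>n. (-1) ^ a * real (n choose a) * lie_fold f (W n a) h x) x"
    proof (rule deriv_eq_on_open[OF assms(1) _ Suc.prems(3)])
      fix y assume "y \<in> D"
      with Suc.prems(1) show "lie_deriv ?A h y = (\<Sum>a\<le>n. (-1) ^ a * real (n choose a) * lie_fold f (W n a) h y)"
        unfolding W_def by (intro Suc.IH Ck_on_SucD[OF Suc.prems(2)]) simp_all
    qed
    also have "\<dots> = (\<Sum>a\<le>n. (-1) ^ a * real (n choose a) * deriv (lie_fold f (W n a) h) x)"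
      by (intro DERIV_imp_deriv DERIV_sum DERIV_cmult Ck_on_imp_DERIV[OF C _ Suc.prems(3)]) simp_all
    finally have "lie_deriv (f i) (lie_deriv ?A h) x =
        (\<Sum>a\<le>n. (-1) ^ a * real (n choose a) * lie_fold f (W n a @ [i]) h x)"
      by (simp add: lie_deriv_def lie_fold_snoc sum_distrib_right mult.assoc)
    moreover have "W n a @ [i] = W (Suc n) a" if "a \<le> n" for a
      using that by (simp add: W_def Suc_diff_le replicate_append_same)
    ultimately show ?thesis by simp
  qed
  \<comment> \<open>Right multiplication: the hypothesis for the start function
    \<open>lie_deriv (f i) h\<close> puts \<open>i\<close> in front of each word, which raises
    \<open>a\<close> by one.\<close>
  have right: "lie_deriv ?A (lie_deriv (f i) h) x =
      (\<Sum>a\<le>n. (-1) ^ a * real (n choose a) * lie_fold f (W (Suc n) (Suc a)) h x)"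
    using Suc.IH[OF _ h1 Suc.prems(3)] Suc.prems(1) by (simp add: W_def)
  have "lie_deriv (ad_pow (Suc n) (f i) (f j)) h x =
      lie_deriv (f i) (lie_deriv ?A h) x - lie_deriv ?A (lie_deriv (f i) h) x"
  proof -
    have "lie_deriv (lie_bracket (f i) ?A) h x =
        lie_deriv (f i) (lie_deriv ?A h) x - lie_deriv ?A (lie_deriv (f i) h) x"
      by (rule lie_deriv_lie_bracket[OF assms(1) Ck_on_antimono[OF fi] A
            Ck_on_antimono[OF Suc.prems(2)] Suc.prems(3)]) simp_all
    then show ?thesis by (simp add: ad_pow_def)
  qed
  then show ?case
    unfolding left right sum_choose_Suc_alternating by (simp add: W_def)
qed

subsection \<open>Iterated integrals\<close>

text \<open>The head letter belongs to the outermost integration, and \<open>G\<close> is evaluated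
  at the innermost time. The constant 1 gives Chen's iterated integrals; a free \<open>G\<close>
  turns concatenation of words into composition and covers the remainder.\<close>

primrec wint :: "('i \<Rightarrow> real \<Rightarrow> real) \<Rightarrow> 'i list \<Rightarrow> (real \<Rightarrow> real) \<Rightarrow> real \<Rightarrow> real" where
  "wint u [] G = G"
| "wint u (k # ks) G = (\<lambda>t. integral {0..t} (\<lambda>s. u k s * wint u ks G s))"

lemma wint_append: "wint u (ks @ ls) G = wint u ks (wint u ls G)"
  by (induction ks) simp_all

lemma nested_integral_cong:
  assumes "\<And>ss. length ss = m \<Longrightarrow> F ss = G ss"
  shows "nested_integral m F t = nested_integral m G t"
  using assms
proof (induction m arbitrary: F G t)
  case (Suc m)
  have "nested_integral m (\<lambda>ss. F (s # ss)) s = nested_integral m (\<lambda>ss. G (s # ss)) s" for s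
    by (rule Suc.IH) (simp add: Suc.prems)
  then show ?case by simp
qed simp

lemma nested_integral_mult_right:
  "nested_integral m (\<lambda>ss. a * F ss) t = a * nested_integral m F t"
  by (induction m arbitrary: F t) simp_all

text \<open>\<open>last (t # ss)\<close> is the innermost time and falls back to \<open>t\<close>
  for the empty word, where the induction starts.\<close>

lemma nested_integral_eq_wint:
  "nested_integral (length ks) (\<lambda>ss. G (last (t # ss)) * (\<Prod>i<length ks. u (ks ! i) (ss ! i))) t =
    wint u ks G t"
proof (induction ks arbitrary: t)
  case (Cons k ks)
  have "(\<lambda>ss. G (last (t # s # ss)) *
          (\<Prod>i<length (k # ks). u ((k # ks) ! i) ((s # ss) ! i))) =
        (\<lambda>ss. u k s * (G (last (s # ss)) * (\<Prod>i<length ks. u (ks ! i) (ss ! i))))" for s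
    by (simp add: prod.lessThan_Suc_shift mult_ac del: prod.lessThan_Suc)
  then show ?case
    by (simp only: list.size nested_integral.simps add_0_right add_Suc_right
        nested_integral_mult_right Cons.IH wint.simps)
qed simp

lemma continuous_on_wint:
  assumes "\<And>k. continuous_on {0..e} (u k)" and "continuous_on {0..e} G"
  shows "continuous_on {0..e} (wint u ks G)"
proof (induction ks)
  case (Cons k ks)
  then show ?case
    using assms by (auto intro!: indefinite_integral_continuous_1 integrable_continuous_real
        continuous_on_mult)
qed (simp add: assms)

lemma wint_cong:
  assumes "\<And>s. s \<in> {0..e} \<Longrightarrow> G s = H s" and "t \<in> {0..e}"
  shows "wint u ks G t = wint u ks H t"
  using assms(2)
proof (induction ks arbitrary: t)
  case (Cons k ks)
  then show ?case
    by (auto intro!: integral_cong)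
qed (simp add: assms)

lemma wint_mult_right: "wint u ks (\<lambda>s. a * G s) t = a * wint u ks G t"
proof (induction ks arbitrary: t)
  case (Cons k ks)
  have "(\<lambda>s. u k s * (a * wint u ks G s)) = (\<lambda>s. a * (u k s * wint u ks G s))"
    by (simp add: mult.left_commute)
  then show ?case by (simp only: wint.simps Cons.IH integral_mult_right)
qed simp

lemma wint_sum:
  assumes "finite I" and "\<And>k. continuous_on {0..e} (u k)"
    and "\<And>i. i \<in> I \<Longrightarrow> continuous_on {0..e} (G i)" and "t \<in> {0..e}"
  shows "wint u ks (\<lambda>s. \<Sum>i\<in>I. G i s) t = (\<Sum>i\<in>I. wint u ks (G i) t)"
  using assms(4)
proof (induction ks arbitrary: t)
  case (Cons k ks)
  have "wint u (k # ks) (\<lambda>s. \<Sum>i\<in>I. G i s) t =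
      integral {0..t} (\<lambda>s. \<Sum>i\<in>I. u k s * wint u ks (G i) s)"
    using Cons by (auto simp: sum_distrib_left intro!: integral_cong)
  also have "\<dots> = (\<Sum>i\<in>I. wint u (k # ks) (G i) t)"
    unfolding wint.simps
  proof (rule integral_sum[OF assms(1)])
    fix i assume "i \<in> I"
    then have "continuous_on {0..e} (\<lambda>s. u k s * wint u ks (G i) s)"
      using assms by (intro continuous_on_mult continuous_on_wint) auto
    then show "(\<lambda>s. u k s * wint u ks (G i) s) integrable_on {0..t}"
      using Cons.prems by (intro integrable_continuous_real) (auto elim: continuous_on_subset)
  qed
  finally show ?case .
qed simp

lemma wint_add:
  assumes "\<And>k. continuous_on {0..e} (u k)"
    and "continuous_on {0..e} G" and "continuous_on {0..e} H" and "t \<in> {0..e}"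
  shows "wint u ks (\<lambda>s. G s + H s) t = wint u ks G t + wint u ks H t"
proof -
  \<comment> \<open>The two summands are indexed by the booleans to reuse
    \<open>wint_sum\<close>.\<close>
  have "wint u ks (\<lambda>s. \<Sum>b\<in>UNIV. case_bool G H b s) t = (\<Sum>b\<in>UNIV. wint u ks (case_bool G H b) t)"
    by (rule wint_sum[OF _ assms(1) _ assms(4)]) (simp_all add: assms(2,3) split: bool.split)
  then show ?thesis by (simp add: UNIV_bool add.commute)
qed

section \<open>Expansion of a trajectory over words\<close>

lemma integral_eq_of_DERIV:
  fixes F h :: "real \<Rightarrow> real"
  assumes d: "\<And>s. s \<in> {0..e} \<Longrightarrow> (F has_real_derivative h s) (at s within {0..e})" and t: "t \<in> {0..e}"
  shows "integral {0..t} h = F t - F 0"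
proof -
  have "(h has_integral (F t - F 0)) {0..t}"
  proof (rule fundamental_theorem_of_calculus)
    show "0 \<le> t" using t by simp
    fix s assume s: "s \<in> {0..t}"
    then have 1: "s \<in> {0..e}" using t by simp
    have 2: "{0..t} \<subseteq> {0..e}" using t by simp
    show "(F has_vector_derivative h s) (at s within {0..t})"
      using DERIV_subset[OF d[OF 1] 2]
      by (simp only: has_real_derivative_iff_has_vector_derivative)
  qed
  then show ?thesis by (rule integral_unique)
qed

text \<open>The last letter is split off, since the expansion lengthens words at the innermost
  integral.\<close>

lemma sum_lists_Suc:
  fixes F :: "'i list \<Rightarrow> 'a::comm_monoid_add"
  shows "(\<Sum>ks | set ks \<subseteq> K \<and> length ks = Suc n. F ks) =
    (\<Sum>ks | set ks \<subseteq> K \<and> length ks = n. \<Sum>k\<in>K. F (ks @ [k]))"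
proof -
  let ?W = "\<lambda>n. {ks. set ks \<subseteq> K \<and> length ks = n}"
  have "(\<Sum>ks\<in>?W (Suc n). F ks) = (\<Sum>(ks, k)\<in>?W n \<times> K. F (ks @ [k]))"
  proof (rule sum.reindex_bij_witness[where i = "\<lambda>(ks, k). ks @ [k]" and j = "\<lambda>ks. (butlast ks, last ks)"])
    fix ks assume ks: "ks \<in> ?W (Suc n)"
    then have "ks \<noteq> []" by auto
    then show "(butlast ks, last ks) \<in> ?W n \<times> K"
      using in_set_butlastD[of _ ks] last_in_set[of ks] ks by auto
    show "(case (butlast ks, last ks) of (ks, k) \<Rightarrow> ks @ [k]) = ks"
      "(case (butlast ks, last ks) of (ks, k) \<Rightarrow> F (ks @ [k])) = F ks"
      using \<open>ks \<noteq> []\<close> by simp_all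
  qed auto
  then show ?thesis by (simp add: sum.cartesian_product)
qed

text \<open>Iterated fundamental theorem of calculus: in the innermost integral,
  \<open>\<phi> ks\<close> is replaced by its initial value plus the integral of its derivative,
  which involves words with one more letter. The family \<open>\<phi>\<close> stands for the Lie
  derivatives along the trajectory.\<close>

lemma chen_fliess_expansion:
  fixes \<phi> :: "'i list \<Rightarrow> real \<Rightarrow> real"
  assumes "finite K" and u: "\<And>k. continuous_on {0..e} (u k)"
    and cont: "\<And>ks. set ks \<subseteq> K \<Longrightarrow> length ks \<le> n \<Longrightarrow> continuous_on {0..e} (\<phi> ks)"
    and deriv: "\<And>ks s. set ks \<subseteq> K \<Longrightarrow> length ks < n \<Longrightarrow> s \<in> {0..e} \<Longrightarrow>
      (\<phi> ks has_real_derivative (\<Sum>k\<in>K. u k s * \<phi> (ks @ [k]) s)) (at s within {0..e})"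
    and t: "t \<in> {0..e}"
  shows "\<phi> [] t = (\<Sum>m<n. \<Sum>ks | set ks \<subseteq> K \<and> length ks = m. \<phi> ks 0 * wint u ks (\<lambda>_. 1) t) +
    (\<Sum>ks | set ks \<subseteq> K \<and> length ks = n. wint u ks (\<phi> ks) t)"
  using cont deriv
proof (induction n)
  case 0
  have "{ks. set ks \<subseteq> K \<and> length ks = 0} = {[]}" by auto
  then show ?case by simp
next
  case (Suc n)
  have *: "wint u ks (\<phi> ks) t =
      \<phi> ks 0 * wint u ks (\<lambda>_. 1) t + (\<Sum>k\<in>K. wint u (ks @ [k]) (\<phi> (ks @ [k])) t)"
    if ks: "set ks \<subseteq> K" "length ks = n" for ks
  proof -
    have c: "continuous_on {0..e} (\<phi> (ks @ [k]))" if "k \<in> K" for k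
      using ks that Suc.prems(1) by simp
    \<comment> \<open>The factor \<open>1\<close> exhibits the initial value as a multiple of the
      constant function, as \<open>wint_mult_right\<close> expects.\<close>
    have I: "\<phi> ks s = \<phi> ks 0 * 1 + (\<Sum>k\<in>K. wint u [k] (\<phi> (ks @ [k])) s)"
      if s: "s \<in> {0..e}" for s
    proof -
      have "\<phi> ks s - \<phi> ks 0 = integral {0..s} (\<lambda>s. \<Sum>k\<in>K. u k s * \<phi> (ks @ [k]) s)"
        using Suc.prems(2)[of ks] ks by (intro integral_eq_of_DERIV[symmetric, OF _ s]) simp
      also have "\<dots> = (\<Sum>k\<in>K. wint u [k] (\<phi> (ks @ [k])) s)"
        unfolding wint.simps using s
        by (intro integral_sum[OF assms(1)] integrable_continuous_real continuous_on_mult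
            continuous_on_subset[OF u] continuous_on_subset[OF c]) auto
      finally show ?thesis by simp
    qed
    have "wint u ks (\<phi> ks) t =
        wint u ks (\<lambda>s. \<phi> ks 0 * 1 + (\<Sum>k\<in>K. wint u [k] (\<phi> (ks @ [k])) s)) t"
      by (rule wint_cong[OF I t])
    also have "\<dots> = wint u ks (\<lambda>s. \<phi> ks 0 * 1) t +
        wint u ks (\<lambda>s. \<Sum>k\<in>K. wint u [k] (\<phi> (ks @ [k])) s) t"
      by (intro wint_add[OF u _ _ t] continuous_on_sum continuous_on_wint[OF u] c) auto
    also have "wint u ks (\<lambda>s. \<Sum>k\<in>K. wint u [k] (\<phi> (ks @ [k])) s) t =
        (\<Sum>k\<in>K. wint u ks (wint u [k] (\<phi> (ks @ [k]))) t)"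
      by (intro wint_sum[OF assms(1) u _ t] continuous_on_wint[OF u] c)
    finally show ?thesis
      unfolding wint_mult_right wint_append .
  qed
  have "(\<Sum>ks | set ks \<subseteq> K \<and> length ks = n. wint u ks (\<phi> ks) t) =
      (\<Sum>ks | set ks \<subseteq> K \<and> length ks = n. \<phi> ks 0 * wint u ks (\<lambda>_. 1) t) +
      (\<Sum>ks | set ks \<subseteq> K \<and> length ks = Suc n. wint u ks (\<phi> ks) t)"
    unfolding sum_lists_Suc sum.distrib[symmetric] by (rule sum.cong) (auto simp: *)
  moreover have "\<phi> [] t = (\<Sum>m<n. \<Sum>ks | set ks \<subseteq> K \<and> length ks = m. \<phi> ks 0 * wint u ks (\<lambda>_. 1) t) +
      (\<Sum>ks | set ks \<subseteq> K \<and> length ks = n. wint u ks (\<phi> ks) t)"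
    by (rule Suc.IH) (use Suc.prems in simp_all)
  ultimately show ?case by (simp only: sum.lessThan_Suc add.assoc)
qed

subsection \<open>Vanishing iterated integrals\<close>

text \<open>\<open>p\<close> and \<open>q\<close> bound the contributions of the letters 1 and 2. A
  single input has \<open>d - n - l\<close> odd; multiplying by an input and integrating each flip
  the parity, so it is even after every completed letter.\<close>

inductive trig_span :: "nat \<Rightarrow> nat \<Rightarrow> nat \<Rightarrow> (real \<Rightarrow> real) \<Rightarrow> bool" for N p q where
  zero: "trig_span N p q (\<lambda>_. 0)"
| add: "trig_span N p q F \<Longrightarrow> \<bar>j\<bar> \<le> int p \<Longrightarrow> \<bar>l\<bar> \<le> int q \<Longrightarrow> n = j + int N * l \<Longrightarrow> even (d - n - l) \<Longrightarrow>
    trig_span N p q (\<lambda>\<theta>. F \<theta> + a * cos (of_int n * \<theta> - of_int d * pi / 2))"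

lemma trig_span_add:
  assumes "trig_span N p q F" and "trig_span N p q G"
  shows "trig_span N p q (\<lambda>\<theta>. F \<theta> + G \<theta>)"
  using assms(2)
proof induction
  case (add G j l n d a)
  show ?case
    using trig_span.add[OF add.IH add.hyps(2-5), of a] by (simp add: add.assoc)
qed (simp add: assms)

lemma trig_span_mult_right:
  assumes "trig_span N p q F"
  shows "trig_span N p q (\<lambda>\<theta>. b * F \<theta>)"
  using assms
proof induction
  case (add F j l n d a)
  show ?case
    using trig_span.add[OF add.IH add.hyps(2-5), of "b * a"] by (simp add: distrib_left mult.assoc)
qed (simp add: trig_span.zero)

lemma trig_span_cos:
  assumes "\<bar>j\<bar> \<le> int p" and "\<bar>l\<bar> \<le> int q" and "n = j + int N * l" and "even (d - n - l)"
  shows "trig_span N p q (\<lambda>\<theta>. a * cos (of_int n * \<theta> - of_int d * pi / 2))"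
  using trig_span.add[OF trig_span.zero assms] by simp

lemma trig_span_const: "trig_span N p q (\<lambda>_. a)"
  using trig_span_cos[of 0 p 0 q 0 N 0] by simp

lemma trig_span_periodic:
  assumes "trig_span N p q F"
  shows "F (2 * pi * real k) = F 0"
  using assms
proof induction
  case (add F j l n d a)
  have "cos (of_int n * (2 * pi * real k) - of_int d * pi / 2) =
      cos (- (of_int d * pi / 2) + (2 * pi) * of_int (n * int k))"
    by (simp add: algebra_simps)
  also have "\<dots> = cos (- (of_int d * pi / 2))"
    unfolding cos_add sin_int_2pin cos_int_2pin by simp
  finally show ?case
    using add by simp
qed simp

text \<open>A resonance \<open>n = j + N l = 0\<close> with \<open>l \<noteq> 0\<close> would force \<open>N \<le> \<bar>j\<bar> \<le> p\<close>; with \<open>l = 0\<close> the phase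
  is an odd multiple of \<open>\<pi> / 2\<close>, so the integrand vanishes.\<close>

lemma trig_span_antiderivative_cos:
  assumes "\<bar>j\<bar> \<le> int p" and "\<bar>l\<bar> \<le> int q" and n: "n = j + int N * l" and "odd (d - n - l)"
    and nonres: "p < N \<or> q = 0"
  shows "\<exists>P. trig_span N p q P \<and> P 0 = 0 \<and>
    (\<forall>\<theta>. (P has_real_derivative cos (of_int n * \<theta> - of_int d * pi / 2)) (at \<theta>))"
proof (cases "n = 0")
  case True
  have "l = 0"
  proof (rule ccontr)
    assume l: "l \<noteq> 0"
    then have "p < N" using nonres assms(2) by auto
    moreover have "\<bar>j\<bar> = int N * \<bar>l\<bar>"
      using True n by (simp add: abs_mult eq_neg_iff_add_eq_0[symmetric])
    moreover have "int N * 1 \<le> int N * \<bar>l\<bar>"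
      using l by (intro mult_left_mono) auto
    ultimately show False using assms(1) by simp
  qed
  then have "odd d" using assms(4) True by simp
  have "cos (of_int n * \<theta> - of_int d * pi / 2) = 0" for \<theta>
    unfolding cos_zero_iff_int by (rule exI[of _ "- d"]) (simp add: True \<open>odd d\<close>)
  then show ?thesis
    by (intro exI[of _ "\<lambda>_. 0"]) (auto intro: trig_span.zero)
next
  case False
  \<comment> \<open>Integration delays the phase by a quarter turn, hence \<open>d + 1\<close>. The
    added constant makes \<open>P 0 = 0\<close> and lies in the span.\<close>
  define P where "P = (\<lambda>\<theta>. 1 / of_int n * cos (of_int n * \<theta> - of_int (d + 1) * pi / 2) +
    - (cos (of_int (d + 1) * pi / 2) / of_int n))"
  have "trig_span N p q P"
    unfolding P_def using assms by (intro trig_span_add trig_span_cos[of j _ l] trig_span_const) auto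
  moreover have "P 0 = 0"
    by (simp add: P_def)
  moreover have "(P has_real_derivative cos (of_int n * \<theta> - of_int d * pi / 2)) (at \<theta>)" for \<theta>
  proof -
    have "of_int n * \<theta> - of_int (d + 1) * pi / 2 = (of_int n * \<theta> - of_int d * pi / 2) - pi / 2"
      by (simp add: field_simps)
    moreover have "sin (z - pi / 2) = - cos z" for z
      by (simp add: sin_diff)
    ultimately have "sin (of_int n * \<theta> - of_int (d + 1) * pi / 2) = - cos (of_int n * \<theta> - of_int d * pi / 2)"
      by (simp only:)
    then show ?thesis
      unfolding P_def using False by (auto intro!: derivative_eq_intros simp del: of_int_add)
  qed
  ultimately show ?thesis by blast
qed

text \<open>The step for one letter, with \<open>i\<close> and \<open>m\<close> its contributions to
  the two counts. The product-to-sum formula yields cosines with data \<open>n + r\<close>,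
  \<open>d + e\<close> and \<open>n - r\<close>, \<open>d - e\<close>; their parities are odd, as
  \<open>trig_span_antiderivative_cos\<close> requires.\<close>

lemma trig_span_antiderivative_mult_cos:
  assumes "trig_span N p q F" and jl: "i \<le> 1" "m \<le> 1" and r: "r = int i + int N * int m"
    and "odd (e - r - int m)" and nonres: "p + i < N \<or> q + m = 0"
  shows "\<exists>P. trig_span N (p + i) (q + m) P \<and> P 0 = 0 \<and>
    (\<forall>\<theta>. (P has_real_derivative cos (of_int r * \<theta> - of_int e * pi / 2) * F \<theta>) (at \<theta>))"
  using assms(1)
proof induction
  case zero
  show ?case by (intro exI[of _ "\<lambda>_. 0"]) (auto intro: trig_span.zero)
next
  case (add F j l n d a)
  obtain P where P: "trig_span N (p + i) (q + m) P" "P 0 = 0"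
    "\<And>\<theta>. (P has_real_derivative cos (of_int r * \<theta> - of_int e * pi / 2) * F \<theta>) (at \<theta>)"
    using add.IH by blast
  have abs_le: "\<bar>j + int i\<bar> \<le> int (p + i)" "\<bar>l + int m\<bar> \<le> int (q + m)"
    and abs_le': "\<bar>j - int i\<bar> \<le> int (p + i)" "\<bar>l - int m\<bar> \<le> int (q + m)"
    using add.hyps(2,3) by simp_all
  have "odd (d + e - (n + r) - (l + int m))"
    using add.hyps(5) assms(5) by presburger
  moreover have "n + r = j + int i + int N * (l + int m)"
    using r add.hyps(4) by (simp add: algebra_simps)
  ultimately obtain Q where Q: "trig_span N (p + i) (q + m) Q" "Q 0 = 0"
    "\<And>\<theta>. (Q has_real_derivative cos (of_int (n + r) * \<theta> - of_int (d + e) * pi / 2)) (at \<theta>)"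
    using trig_span_antiderivative_cos[of "j + int i" "p + i" "l + int m" "q + m" "n + r" N "d + e",
        OF abs_le _ _ nonres] by blast
  have "odd (d - e - (n - r) - (l - int m))"
    using add.hyps(5) assms(5) by presburger
  moreover have "n - r = j - int i + int N * (l - int m)"
    using r add.hyps(4) by (simp add: algebra_simps)
  ultimately obtain R where R: "trig_span N (p + i) (q + m) R" "R 0 = 0"
    "\<And>\<theta>. (R has_real_derivative cos (of_int (n - r) * \<theta> - of_int (d - e) * pi / 2)) (at \<theta>)"
    using trig_span_antiderivative_cos[of "j - int i" "p + i" "l - int m" "q + m" "n - r" N "d - e",
        OF abs_le' _ _ nonres] by blast
  have prod: "cos (of_int r * \<theta> - of_int e * pi / 2) * cos (of_int n * \<theta> - of_int d * pi / 2) =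
      (cos (of_int (n + r) * \<theta> - of_int (d + e) * pi / 2) +
       cos (of_int (n - r) * \<theta> - of_int (d - e) * pi / 2)) / 2" for \<theta>
  proof -
    let ?x = "of_int n * \<theta> - of_int d * pi / 2" and ?y = "of_int r * \<theta> - of_int e * pi / 2"
    have "of_int (n + r) * \<theta> - of_int (d + e) * pi / 2 = ?x + ?y"
      "of_int (n - r) * \<theta> - of_int (d - e) * pi / 2 = ?x - ?y"
      by (simp_all add: field_simps)
    then show ?thesis
      using cos_times_cos[of ?x ?y] by (simp only: mult.commute add.commute)
  qed
  let ?S = "\<lambda>\<theta>. P \<theta> + (a / 2) * (Q \<theta> + R \<theta>)"
  have "trig_span N (p + i) (q + m) ?S"
    by (intro trig_span_add trig_span_mult_right P Q R)
  moreover have "?S 0 = 0"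
    using P Q R by simp
  moreover have "(?S has_real_derivative cos (of_int r * \<theta> - of_int e * pi / 2) *
      (F \<theta> + a * cos (of_int n * \<theta> - of_int d * pi / 2))) (at \<theta>)" for \<theta>
  proof -
    have "(?S has_real_derivative cos (of_int r * \<theta> - of_int e * pi / 2) * F \<theta> + (a / 2) *
      (cos (of_int (n + r) * \<theta> - of_int (d + e) * pi / 2) +
       cos (of_int (n - r) * \<theta> - of_int (d - e) * pi / 2))) (at \<theta>)"
      by (intro DERIV_add DERIV_cmult P Q R)
    also have "(a / 2) * (cos (of_int (n + r) * \<theta> - of_int (d + e) * pi / 2) +
       cos (of_int (n - r) * \<theta> - of_int (d - e) * pi / 2)) =
       a * (cos (of_int r * \<theta> - of_int e * pi / 2) * cos (of_int n * \<theta> - of_int d * pi / 2))"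
      unfolding prod by simp
    finally show ?thesis by (simp add: algebra_simps)
  qed
  ultimately show ?case by blast
qed

text \<open>Induction from the innermost letter outwards, in the variable
  \<open>\<theta> = \<omega> t\<close>. The tail has no larger counts, so it inherits the condition
  on them. The empty word gives the constant 1, hence the proviso for
  \<open>F 0 = 0\<close>.\<close>

lemma wint_in_trig_span:
  fixes u :: "nat \<Rightarrow> real \<Rightarrow> real" and \<alpha> :: "nat \<Rightarrow> real"
  assumes "\<omega> > 0"
    and u1: "\<And>s. u 1 s = \<alpha> 1 * cos (\<omega> * s)"
    and u2: "\<And>s. u 2 s = \<alpha> 2 * cos (real N * (\<omega> * s) - real N * pi / 2)"
    and "set ks \<subseteq> {1, 2}" and "count_list ks 1 < N \<or> count_list ks 2 = 0"
  shows "\<exists>F. trig_span N (count_list ks 1) (count_list ks 2) F \<and>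
    (ks \<noteq> [] \<longrightarrow> F 0 = 0) \<and> (\<forall>t\<ge>0. wint u ks (\<lambda>_. 1) t = F (\<omega> * t))"
  using assms(4,5)
proof (induction ks)
  case Nil
  show ?case by (intro exI[of _ "\<lambda>_. 1"]) (auto intro: trig_span_const)
next
  case (Cons k ks)
  \<comment> \<open>Frequency \<open>r\<close> and phase index \<open>e\<close> of the input for the
    letter \<open>k\<close>; \<open>i\<close> and \<open>m\<close> are its contributions to the
    counts of 1 and 2.\<close>
  define r where "r = (if k = 1 then 1 else int N)"
  define e where "e = (if k = 1 then 0 else int N)"
  define i where "i = (if k = 1 then 1 else 0 :: nat)"
  define m where "m = (if k = 1 then 0 else 1 :: nat)"
  have k: "k = 1 \<or> k = 2" using Cons.prems by auto
  have count: "count_list (k # ks) 1 = count_list ks 1 + i" "count_list (k # ks) 2 = count_list ks 2 + m"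
    using k by (auto simp: i_def m_def)
  have "set ks \<subseteq> {1, 2}" "count_list ks 1 < N \<or> count_list ks 2 = 0"
    using Cons.prems k by (auto split: if_splits)
  from Cons.IH[OF this] obtain F where F: "trig_span N (count_list ks 1) (count_list ks 2) F"
    "\<And>t. t \<ge> 0 \<Longrightarrow> wint u ks (\<lambda>_. 1) t = F (\<omega> * t)"
    by blast
  have u: "u k s = \<alpha> k * cos (of_int r * (\<omega> * s) - of_int e * pi / 2)" for s
    using k u1 u2 by (auto simp: r_def e_def)
  have im: "i \<le> 1" "m \<le> 1" "r = int i + int N * int m" "odd (e - r - int m)"
    "count_list ks 1 + i < N \<or> count_list ks 2 + m = 0"
    using Cons.prems(2) unfolding count by (auto simp: r_def e_def i_def m_def)
  obtain P where P: "trig_span N (count_list ks 1 + i) (count_list ks 2 + m) P" "P 0 = 0"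
    "\<And>\<theta>. (P has_real_derivative cos (of_int r * \<theta> - of_int e * pi / 2) * F \<theta>) (at \<theta>)"
    using trig_span_antiderivative_mult_cos[OF F(1) im(1,2) im(3) im(4) im(5)] by blast
  \<comment> \<open>\<open>\<alpha> k\<close> is the amplitude, and \<open>1 / \<omega>\<close>
    compensates the change of variable.\<close>
  let ?G = "\<lambda>\<theta>. \<alpha> k / \<omega> * P \<theta>"
  have "wint u (k # ks) (\<lambda>_. 1) t = ?G (\<omega> * t)" if "t \<ge> 0" for t
  proof -
    have "wint u (k # ks) (\<lambda>_. 1) t = integral {0..t} (\<lambda>s. u k s * F (\<omega> * s))"
      by (auto intro!: integral_cong simp: F(2))
    also have "\<dots> = ?G (\<omega> * t) - ?G (\<omega> * 0)"
    proof (rule integral_eq_of_DERIV[of t])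
      fix s
      have "((\<lambda>s. P (\<omega> * s)) has_real_derivative
          cos (of_int r * (\<omega> * s) - of_int e * pi / 2) * F (\<omega> * s) * \<omega>) (at s within {0..t})"
        by (rule DERIV_chain2[OF P(3)]) (auto intro!: derivative_eq_intros)
      from DERIV_cmult[OF this, of "\<alpha> k / \<omega>"]
      show "((\<lambda>s. ?G (\<omega> * s)) has_real_derivative u k s * F (\<omega> * s)) (at s within {0..t})"
        using \<open>\<omega> > 0\<close> by (simp add: u mult.assoc)
    qed (use that in auto)
    finally show ?thesis using P(2) by simp
  qed
  moreover have "trig_span N (count_list (k # ks) 1) (count_list (k # ks) 2) ?G"
    unfolding count by (rule trig_span_mult_right[OF P(1)])
  ultimately show ?case using P(2) by (intro exI[of _ ?G]) auto
qed

text \<open>\<open>T\<close> spans \<open>\<kappa>\<close> full turns, so the trigonometric sum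
  takes at \<open>T\<close> its value at 0, which is 0 for a nonempty word.\<close>

lemma wint_period_eq_0:
  fixes u :: "nat \<Rightarrow> real \<Rightarrow> real" and \<alpha> :: "nat \<Rightarrow> real"
  assumes "\<omega> > 0" and "\<omega> * T = 2 * pi * real \<kappa>"
    and "\<And>s. u 1 s = \<alpha> 1 * cos (\<omega> * s)"
    and "\<And>s. u 2 s = \<alpha> 2 * cos (real N * (\<omega> * s) - real N * pi / 2)"
    and "set ks \<subseteq> {1, 2}" and "count_list ks 1 < N \<or> count_list ks 2 = 0" and "ks \<noteq> []"
  shows "wint u ks (\<lambda>_. 1) T = 0"
proof -
  have "T \<ge> 0"
  proof -
    have "\<omega> * T \<ge> 0" by (simp add: assms(2))
    then show ?thesis using \<open>\<omega> > 0\<close> by (simp add: zero_le_mult_iff)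
  qed
  then show ?thesis
    using wint_in_trig_span[OF assms(1,3-6)] assms(2,7) by (auto dest: trig_span_periodic[of _ _ _ _ \<kappa>])
qed

subsection \<open>Words with one exceptional letter\<close>

text \<open>Since \<open>u i\<close> is the derivative of \<open>S\<close>, the integrand
  \<open>u i s * S s ^ b / fact b\<close> is an exact derivative.\<close>

lemma wint_replicate:
  fixes u :: "'i \<Rightarrow> real \<Rightarrow> real"
  assumes S: "\<And>s. s \<in> {0..e} \<Longrightarrow> (S has_real_derivative u i s) (at s within {0..e})" and "S 0 = 0"
    and "t \<in> {0..e}"
  shows "wint u (replicate b i) (\<lambda>_. 1) t = S t ^ b / fact b"
  using assms(3)
proof (induction b arbitrary: t)
  case (Suc b)
  have "wint u (replicate (Suc b) i) (\<lambda>_. 1) t = integral {0..t} (\<lambda>s. u i s * (S s ^ b / fact b))"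
    unfolding replicate.simps wint.simps
  proof (rule integral_cong)
    fix s assume "s \<in> {0..t}"
    with Suc.prems have "s \<in> {0..e}" by simp
    then show "u i s * wint u (replicate b i) (\<lambda>_. 1) s = u i s * (S s ^ b / fact b)"
      by (simp only: Suc.IH)
  qed
  also have "\<dots> = S t ^ Suc b / fact (Suc b) - S 0 ^ Suc b / fact (Suc b)"
  proof (rule integral_eq_of_DERIV[OF _ Suc.prems])
    fix s assume s: "s \<in> {0..e}"
    have "((\<lambda>s. S s ^ Suc b / fact (Suc b)) has_real_derivative
        (1 + real b) * (u i s * S s ^ b) / fact (Suc b)) (at s within {0..e})"
      by (intro DERIV_cdivide DERIV_power_Suc S s)
    then show "((\<lambda>s. S s ^ Suc b / fact (Suc b)) has_real_derivative
        u i s * (S s ^ b / fact b)) (at s within {0..e})"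
      using nonzero_mult_divide_mult_cancel_left[of "1 + real b" "u i s * S s ^ b" "fact b"] by simp
  qed
  finally show ?case by (simp add: \<open>S 0 = 0\<close>)
qed simp

text \<open>At the time \<open>s\<close> of the letter \<open>j\<close>, the inner block contributes
  \<open>S s ^ b / fact b\<close> and the outer block \<open>(S t - S s) ^ a / fact a\<close>; the
  right-hand side is the binomial expansion of the resulting integral. Differentiating this sum
  avoids exchanging integrals.\<close>

lemma wint_insert_replicate:
  fixes u :: "'i \<Rightarrow> real \<Rightarrow> real"
  assumes S: "\<And>s. s \<in> {0..e} \<Longrightarrow> (S has_real_derivative u i s) (at s within {0..e})" and "S 0 = 0"
    and uj: "continuous_on {0..e} (u j)" and t: "t \<in> {0..e}"
  defines "H \<equiv> \<lambda>n t. integral {0..t} (\<lambda>s. u j s * S s ^ n)"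
  shows "wint u (replicate a i @ j # replicate b i) (\<lambda>_. 1) t =
    (\<Sum>m\<le>a. (-1) ^ m * real (a choose m) * S t ^ (a - m) * H (b + m) t) / (fact a * fact b)"
  using t
proof (induction a arbitrary: t)
  case 0
  have "wint u (j # replicate b i) (\<lambda>_. 1) t = integral {0..t} (\<lambda>s. 1 / fact b * (u j s * S s ^ b))"
    unfolding wint.simps
  proof (rule integral_cong)
    fix s assume "s \<in> {0..t}"
    with 0 have "s \<in> {0..e}" by simp
    then show "u j s * wint u (replicate b i) (\<lambda>_. 1) s = 1 / fact b * (u j s * S s ^ b)"
      using wint_replicate[of e S u i, OF S \<open>S 0 = 0\<close>] by simp
  qed
  also have "\<dots> = H b t / fact b"
    unfolding H_def integral_mult_right by simp
  finally show ?case by simp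
next
  case (Suc a)
  have contS: "continuous_on {0..e} S"
    by (rule DERIV_continuous_on[OF S])
  have H: "(H n has_real_derivative u j s * S s ^ n) (at s within {0..e})" if "s \<in> {0..e}" for n s
    unfolding H_def
    by (intro integral_has_real_derivative[OF _ that] continuous_on_mult uj continuous_on_power contS)
  have H0: "H n 0 = 0" for n by (simp add: H_def)
  define Q where "Q a t = (\<Sum>m\<le>a. (-1) ^ m * real (a choose m) * S t ^ (a - m) * H (b + m) t)" for a t
  \<comment> \<open>Differentiating the moments \<open>H\<close> produces the power
    \<open>S s ^ (b + Suc a)\<close> in every summand, and the alternating binomial sum annihilates
    these terms. The absorption identity turns the others into a multiple of
    \<open>Q a\<close>.\<close>
  have Q: "(Q (Suc a) has_real_derivative real (Suc a) * (u i s * Q a s)) (at s within {0..e})"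
    if s: "s \<in> {0..e}" for s
  proof -
    have "(Q (Suc a) has_real_derivative
        (\<Sum>m\<le>Suc a. (-1) ^ m * real (Suc a choose m) *
          (real (Suc a - m) * (u i s * S s ^ (Suc a - m - Suc 0)) * H (b + m) s +
           u j s * S s ^ (b + m) * S s ^ (Suc a - m)))) (at s within {0..e})"
      unfolding Q_def[abs_def] mult.assoc[of _ "S _ ^ _" "H _ _"]
      by (intro DERIV_sum DERIV_cmult DERIV_mult DERIV_power S H s)
    also have "(\<Sum>m\<le>Suc a. (-1) ^ m * real (Suc a choose m) *
          (real (Suc a - m) * (u i s * S s ^ (Suc a - m - Suc 0)) * H (b + m) s +
           u j s * S s ^ (b + m) * S s ^ (Suc a - m))) =
        (\<Sum>m\<le>Suc a. (-1) ^ m * (real (Suc a choose m) * real (Suc a - m)) *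
          (u i s * S s ^ (Suc a - m - Suc 0) * H (b + m) s)) +
        (\<Sum>m\<le>Suc a. (-1) ^ m * real (Suc a choose m) * (u j s * S s ^ (b + Suc a)))"
      unfolding sum.distrib[symmetric]
    proof (rule sum.cong[OF refl])
      fix m assume "m \<in> {..Suc a}"
      then have "b + m + (Suc a - m) = b + Suc a" by simp
      then have "S s ^ (b + m) * S s ^ (Suc a - m) = S s ^ (b + Suc a)"
        by (simp only: power_add[symmetric])
      then show "(-1) ^ m * real (Suc a choose m) *
          (real (Suc a - m) * (u i s * S s ^ (Suc a - m - Suc 0)) * H (b + m) s +
           u j s * S s ^ (b + m) * S s ^ (Suc a - m)) =
        (-1) ^ m * (real (Suc a choose m) * real (Suc a - m)) *
          (u i s * S s ^ (Suc a - m - Suc 0) * H (b + m) s) +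
        (-1) ^ m * real (Suc a choose m) * (u j s * S s ^ (b + Suc a))"
        by (simp only: mult.assoc distrib_left mult.left_commute)
    qed
    also have "(\<Sum>m\<le>Suc a. (-1) ^ m * real (Suc a choose m) * (u j s * S s ^ (b + Suc a))) = 0"
      unfolding sum_distrib_right[symmetric] using choose_alternating_sum[of "Suc a", where 'a = real]
      by simp
    \<comment> \<open>The summand \<open>m = Suc a\<close> drops out because of the factor
      \<open>Suc a - m\<close>.\<close>
    also have "(\<Sum>m\<le>Suc a. (-1) ^ m * (real (Suc a choose m) * real (Suc a - m)) *
          (u i s * S s ^ (Suc a - m - Suc 0) * H (b + m) s)) =
        (\<Sum>m\<le>a. (-1) ^ m * (real (Suc a choose m) * real (Suc a - m)) *
          (u i s * S s ^ (Suc a - m - Suc 0) * H (b + m) s))"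
      by simp
    also have "\<dots> = real (Suc a) * (u i s * Q a s)"
      unfolding Q_def sum_distrib_left
    proof (rule sum.cong[OF refl])
      fix m assume "m \<in> {..a}"
      then have m: "m \<le> a" by simp
      have "(Suc a choose m) * (Suc a - m) = Suc a * (a choose m)"
        using binomial_absorb_comp[of "Suc a" m] by (simp add: mult.commute)
      then have "real (Suc a choose m) * real (Suc a - m) = real (Suc a) * real (a choose m)"
        by (metis of_nat_mult)
      moreover have "Suc a - m - Suc 0 = a - m" by simp
      ultimately show "(-1) ^ m * (real (Suc a choose m) * real (Suc a - m)) *
          (u i s * S s ^ (Suc a - m - Suc 0) * H (b + m) s) =
        real (Suc a) * (u i s * ((-1) ^ m * real (a choose m) * S s ^ (a - m) * H (b + m) s))"
        by (simp only: mult_ac)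
    qed
    finally show ?thesis by simp
  qed
  have "wint u (replicate (Suc a) i @ j # replicate b i) (\<lambda>_. 1) t =
      integral {0..t} (\<lambda>s. real (Suc a) * (u i s * Q a s) / (fact (Suc a) * fact b))"
    unfolding replicate.simps append_Cons wint.simps
  proof (rule integral_cong)
    fix s assume "s \<in> {0..t}"
    with Suc.prems have "s \<in> {0..e}" by simp
    from Suc.IH[OF this] show "u i s * wint u (replicate a i @ j # replicate b i) (\<lambda>_. 1) s =
        real (Suc a) * (u i s * Q a s) / (fact (Suc a) * fact b)"
      unfolding Q_def by (simp del: of_nat_Suc)
  qed
  also have "\<dots> = Q (Suc a) t / (fact (Suc a) * fact b) - Q (Suc a) 0 / (fact (Suc a) * fact b)"
    by (rule integral_eq_of_DERIV[OF _ Suc.prems]) (intro DERIV_cdivide Q)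
  also have "Q (Suc a) 0 = 0"
    by (simp add: Q_def H0)
  finally show ?case by (simp add: Q_def)
qed

text \<open>\<open>S e = 0\<close> removes every summand except \<open>m = a\<close>, where
  \<open>S e ^ 0 = 1\<close>. For fixed \<open>a + b\<close>, the position of \<open>j\<close>
  enters only through the sign and the factorials.\<close>

lemma wint_insert_replicate_closed:
  fixes u :: "'i \<Rightarrow> real \<Rightarrow> real"
  assumes "\<And>s. s \<in> {0..e} \<Longrightarrow> (S has_real_derivative u i s) (at s within {0..e})"
    and "S 0 = 0" and "S e = 0" and "continuous_on {0..e} (u j)" and "e \<ge> 0"
  shows "wint u (replicate a i @ j # replicate b i) (\<lambda>_. 1) e =
    (-1) ^ a * integral {0..e} (\<lambda>s. u j s * S s ^ (a + b)) / (fact a * fact b)"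
proof -
  have "(\<Sum>m\<le>a. (-1) ^ m * real (a choose m) * S e ^ (a - m) *
      integral {0..e} (\<lambda>s. u j s * S s ^ (b + m))) =
    (\<Sum>m\<in>{a}. (-1) ^ m * real (a choose m) * S e ^ (a - m) *
      integral {0..e} (\<lambda>s. u j s * S s ^ (b + m)))"
    using assms(3) by (intro sum.mono_neutral_right) (auto simp: power_0_left)
  then show ?thesis
    using wint_insert_replicate[of e S u i j e a b, OF assms(1,2,4)] assms(5) by (simp add: add.commute)
qed

text \<open>In terms of \<open>y = \<omega> s - \<pi> / 2\<close> the integrand is \<open>cos y ^ N * cos (N y)\<close>. Its double is the sum of
  the integrand for \<open>N - 1\<close> and a multiple of the derivative of \<open>cos y ^ N * sin (N y)\<close>.\<close>

lemma integral_sin_power_mult_cos: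
  assumes "\<omega> > 0" and "T \<ge> 0" and T: "\<omega> * T = 2 * pi * real \<kappa>"
  shows "integral {0..T} (\<lambda>s. sin (\<omega> * s) ^ N * cos (real N * (\<omega> * s) - real N * pi / 2)) = T / 2 ^ N"
proof -
  define y where "y s = \<omega> * s - pi / 2" for s
  have y: "sin (\<omega> * s) = cos (y s)" "real n * (\<omega> * s) - real n * pi / 2 = real n * y s" for s n
    by (simp_all add: y_def cos_diff algebra_simps)
  have y0: "cos (y 0) = 0" "cos (y T) = 0"
    using sin_int_2pin[of "int \<kappa>"] by (simp_all flip: y(1) add: T)
  have "integral {0..T} (\<lambda>s. cos (y s) ^ N * cos (real N * y s)) = T / 2 ^ N"
  proof (induction N)
    case 0
    show ?case using \<open>T \<ge> 0\<close> by simp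
  next
    case (Suc N)
    \<comment> \<open>The product rule and the addition formula give \<open>?P\<close> the
      derivative \<open>?p\<close>. Its factor \<open>cos (y s)\<close> vanishes at both ends, so
      \<open>?p\<close> integrates to 0.\<close>
    let ?P = "\<lambda>s. cos (y s) ^ Suc N * sin (real (Suc N) * y s) / (2 * \<omega> * real (Suc N))"
    let ?p = "\<lambda>s. cos (y s) ^ N * cos (real (Suc (Suc N)) * y s) / 2"
    have "integral {0..T} ?p = ?P T - ?P 0"
    proof (rule integral_eq_of_DERIV[of T])
      fix s
      have dy: "(y has_real_derivative \<omega>) (at s within {0..T})"
        unfolding y_def[abs_def] by (auto intro!: derivative_eq_intros)
      have cy: "((\<lambda>s. cos (y s)) has_real_derivative - sin (y s) * \<omega>) (at s within {0..T})"
        by (rule DERIV_chain2[OF DERIV_cos dy])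
      have sy: "((\<lambda>s. sin (real (Suc N) * y s)) has_real_derivative
          cos (real (Suc N) * y s) * (real (Suc N) * \<omega>)) (at s within {0..T})"
        by (rule DERIV_chain2[OF DERIV_sin DERIV_cmult[OF dy]])
      have "(?P has_real_derivative
          ((1 + real N) * (- sin (y s) * \<omega> * cos (y s) ^ N) * sin (real (Suc N) * y s) +
           cos (real (Suc N) * y s) * (real (Suc N) * \<omega>) * cos (y s) ^ Suc N) /
          (2 * \<omega> * real (Suc N))) (at s within {0..T})"
        by (intro DERIV_cdivide DERIV_mult DERIV_power_Suc cy sy)
      also have "(1 + real N) * (- sin (y s) * \<omega> * cos (y s) ^ N) * sin (real (Suc N) * y s) +
           cos (real (Suc N) * y s) * (real (Suc N) * \<omega>) * cos (y s) ^ Suc N =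
           (\<omega> * real (Suc N)) * (cos (y s) ^ N *
             (cos (real (Suc N) * y s) * cos (y s) - sin (real (Suc N) * y s) * sin (y s)))"
        unfolding of_nat_Suc power_Suc by algebra
      also have "cos (real (Suc N) * y s) * cos (y s) - sin (real (Suc N) * y s) * sin (y s) =
          cos (real (Suc (Suc N)) * y s)"
        by (simp add: cos_add[symmetric] algebra_simps)
      also have "\<omega> * real (Suc N) * (cos (y s) ^ N * cos (real (Suc (Suc N)) * y s)) /
          (2 * \<omega> * real (Suc N)) = ?p s"
        using \<open>\<omega> > 0\<close> by (simp del: of_nat_Suc)
      finally show "(?P has_real_derivative ?p s) (at s within {0..T})" .
    qed (use \<open>T \<ge> 0\<close> in simp)
    then have p: "integral {0..T} ?p = 0"
      by (simp add: y0)
    have "cos (y s) ^ Suc N * cos (real (Suc N) * y s) =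
        ?p s + 1 / 2 * (cos (y s) ^ N * cos (real N * y s))" for s
    proof -
      have *: "cos (real (Suc (Suc N)) * y s) + cos (real N * y s) = 2 * (cos (real (Suc N) * y s) * cos (y s))"
        using cos_add[of "real (Suc N) * y s" "y s"] cos_diff[of "real (Suc N) * y s" "y s"]
        by (simp add: algebra_simps)
      have "cos (y s) ^ Suc N * cos (real (Suc N) * y s) =
          cos (y s) ^ N * (2 * (cos (real (Suc N) * y s) * cos (y s))) / 2"
        by (simp del: of_nat_Suc)
      then show ?thesis
        unfolding *[symmetric] by (simp add: distrib_left add_divide_distrib del: of_nat_Suc)
    qed
    then have "integral {0..T} (\<lambda>s. cos (y s) ^ Suc N * cos (real (Suc N) * y s)) =
        integral {0..T} (\<lambda>s. ?p s + 1 / 2 * (cos (y s) ^ N * cos (real N * y s)))"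
      by (simp only:)
    also have "\<dots> = integral {0..T} ?p + integral {0..T} (\<lambda>s. 1 / 2 * (cos (y s) ^ N * cos (real N * y s)))"
      unfolding y_def
      by (intro integral_add integrable_continuous_real continuous_intros) auto
    also have "\<dots> = T / 2 ^ Suc N"
      unfolding p integral_mult_right Suc.IH by simp
    finally show ?case .
  qed
  then show ?thesis by (simp only: y)
qed

text \<open>This covers the sine and the cosine case of the second input at once; the sign is the
  one that \<open>(-1) ^ (N div 2)\<close> in the condition on \<open>c\<close> offsets.\<close>

lemma cos_diff_nat_half_pi:
  "cos (x - real n * pi / 2) = (-1) ^ (n div 2) * (if odd n then sin x else cos x)"
proof (cases "odd n")
  case True
  then obtain k where n: "n = 2 * k + 1" by (elim oddE)
  have "x - real n * pi / 2 = (x - pi / 2) - real k * pi" by (simp add: n field_simps)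
  then have "cos (x - real n * pi / 2) = cos ((x - pi / 2) - real k * pi)" by (simp only:)
  also have "\<dots> = (-1) ^ k * sin x" by (simp add: cos_diff)
  finally show ?thesis by (simp add: n)
next
  case False
  then obtain k where n: "n = 2 * k" by (auto elim: evenE)
  have "x - real n * pi / 2 = x - real k * pi" by (simp add: n)
  then have "cos (x - real n * pi / 2) = cos (x - real k * pi)" by (simp only:)
  then show ?thesis by (simp add: n cos_diff)
qed

section \<open>Counting and listing words in two letters\<close>

lemma count_list_two_letters:
  assumes "i \<noteq> j" and "set ks \<subseteq> {i, j}"
  shows "count_list ks i + count_list ks j = length ks"
  using assms(2) by (induction ks) (use assms(1) in auto)

text \<open>Cutting at the only \<open>j\<close> indexes the words by the number \<open>a\<close> of
  letters before it.\<close>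

lemma lists_with_one_occurrence:
  assumes "i \<noteq> j"
  shows "{ks. set ks \<subseteq> {i, j} \<and> length ks = Suc n \<and> count_list ks j = 1} =
    (\<lambda>a. replicate a i @ j # replicate (n - a) i) ` {..n}"
proof (intro equalityI subsetI)
  fix ks assume ks: "ks \<in> {ks. set ks \<subseteq> {i, j} \<and> length ks = Suc n \<and> count_list ks j = 1}"
  then have "count_list ks j \<noteq> 0" by simp
  then have "j \<in> set ks" using count_notin by fastforce
  then obtain ys zs where split: "ks = ys @ j # zs" by (auto dest: split_list)
  have "count_list ys j + count_list zs j = 0" using ks by (simp add: split)
  then have "j \<notin> set ys" "j \<notin> set zs" by (auto simp: count_list_0_iff)
  then have "ys = replicate (length ys) i" "zs = replicate (length zs) i"
    using ks by (auto simp: split intro!: replicate_eqI)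
  moreover have "length ys \<le> n" "length zs = n - length ys" using ks by (auto simp: split)
  ultimately show "ks \<in> (\<lambda>a. replicate a i @ j # replicate (n - a) i) ` {..n}"
    using split by (intro image_eqI[of _ _ "length ys"]) auto
next
  fix ks assume "ks \<in> (\<lambda>a. replicate a i @ j # replicate (n - a) i) ` {..n}"
  then obtain a where "a \<le> n" "ks = replicate a i @ j # replicate (n - a) i" by auto
  moreover have "count_list (replicate m i) j = 0" for m
    using assms by (auto simp: count_list_0_iff)
  ultimately show "ks \<in> {ks. set ks \<subseteq> {i, j} \<and> length ks = Suc n \<and> count_list ks j = 1}"
    by auto
qed

lemma inj_on_insert_replicate:
  assumes "i \<noteq> j"
  shows "inj_on (\<lambda>a. replicate a i @ j # replicate (n - a) i) A"
proof (rule inj_onI)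
  fix a b assume "replicate a i @ j # replicate (n - a) i = replicate b i @ j # replicate (n - b) i"
  \<comment> \<open>\<open>takeWhile\<close> recovers the block in front of \<open>j\<close>,
    because \<open>j\<close> differs from \<open>i\<close>.\<close>
  then have "takeWhile (\<lambda>k. k = i) (replicate a i @ j # replicate (n - a) i) =
      takeWhile (\<lambda>k. k = i) (replicate b i @ j # replicate (n - b) i)"
    by simp
  then have "replicate a i = replicate b i"
    using assms by (simp add: takeWhile_append)
  then show "a = b" by simp
qed

subsection \<open>The two inputs\<close>

lemma control_eq:
  fixes N \<kappa> :: nat
  assumes "\<epsilon> > 0"
  defines "\<omega> \<equiv> 2 * pi * real \<kappa> / \<epsilon>" and "A \<equiv> \<epsilon> powr (- (real N / real (N + 1)))"
  shows "control N \<kappa> c \<epsilon> 1 s = A * c 1 * cos (\<omega> * s)"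
    and "control N \<kappa> c \<epsilon> 2 s =
      A * c 2 * (-1) ^ (N div 2) * cos (real N * (\<omega> * s) - real N * pi / 2)"
proof -
  have "2 * real \<kappa> * pi * s / \<epsilon> = \<omega> * s" "2 * real N * real \<kappa> * pi * s / \<epsilon> = real N * (\<omega> * s)"
    by (simp_all add: \<omega>_def)
  then have d: "dither N \<kappa> \<epsilon> 1 s = cos (\<omega> * s)"
    "dither N \<kappa> \<epsilon> 2 s = (if odd N then sin (real N * (\<omega> * s)) else cos (real N * (\<omega> * s)))"
    by (simp_all only: dither_def) simp_all
  show "control N \<kappa> c \<epsilon> 1 s = A * c 1 * cos (\<omega> * s)"
    by (simp only: control_def d A_def)
  \<comment> \<open>The sign produced by \<open>cos_diff_nat_half_pi\<close> meets the explicit one,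
    and their product is 1.\<close>
  have "(-1) ^ (N div 2) * cos (real N * (\<omega> * s) - real N * pi / 2) = dither N \<kappa> \<epsilon> 2 s"
    unfolding cos_diff_nat_half_pi d(2) by (simp only: mult.assoc[symmetric] power_mult_distrib[symmetric]) simp
  then show "control N \<kappa> c \<epsilon> 2 s =
      A * c 2 * (-1) ^ (N div 2) * cos (real N * (\<omega> * s) - real N * pi / 2)"
    by (simp only: control_def A_def mult.assoc)
qed

text \<open>The scaling and the condition on \<open>c\<close> enter here: the \<open>N + 1\<close>
  amplitudes contribute \<open>1 / \<epsilon> ^ N\<close>, the primitives
  \<open>\<epsilon> ^ N\<close> through \<open>\<omega>\<close>, and the integral one factor
  \<open>\<epsilon>\<close>. The constants reduce to \<open>fact N\<close>, which the factorials of
  the two blocks turn into the binomial coefficient.\<close>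

lemma wint_control_insert:
  assumes "\<epsilon> > 0" and "\<kappa> \<ge> 1" and "a \<le> N"
    and c: "c 1 ^ N * c 2 = (4 * pi * real \<kappa>) ^ N * fact N * (-1) ^ (N div 2)"
  shows "wint (control N \<kappa> c \<epsilon>) (replicate a 1 @ 2 # replicate (N - a) 1) (\<lambda>_. 1) \<epsilon> =
    \<epsilon> * ((-1) ^ a * real (N choose a))"
proof -
  let ?u = "control N \<kappa> c \<epsilon>"
  define \<omega> where "\<omega> = 2 * pi * real \<kappa> / \<epsilon>"
  define A where "A = \<epsilon> powr (- (real N / real (N + 1)))"
  define \<sigma> :: real where "\<sigma> = (-1) ^ (N div 2)"
  \<comment> \<open>The primitive of the first input; it vanishes at both 0 and
    \<open>\<epsilon>\<close>, as \<open>wint_insert_replicate_closed\<close> requires.\<close>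
  define S where "S = (\<lambda>s. A * c 1 / \<omega> * sin (\<omega> * s))"
  note u = control_eq[OF \<open>\<epsilon> > 0\<close>, of N \<kappa> c, folded \<omega>_def A_def \<sigma>_def]
  have \<omega>: "\<omega> > 0" "\<omega> * \<epsilon> = 2 * pi * real \<kappa>"
    using assms(1,2) by (simp_all add: \<omega>_def)
  have \<sigma>: "\<sigma> * \<sigma> = 1"
    by (simp add: \<sigma>_def flip: power_mult_distrib)
  have "(S has_real_derivative ?u 1 s) (at s within {0..\<epsilon>})" for s
  proof -
    have "((\<lambda>s. sin (\<omega> * s)) has_real_derivative cos (\<omega> * s) * \<omega>) (at s within {0..\<epsilon>})"
      by (rule DERIV_chain2[OF DERIV_sin]) (auto intro!: derivative_eq_intros)
    from DERIV_cmult[OF this, of "A * c 1 / \<omega>"] show ?thesis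
      unfolding S_def u using \<omega>(1) by (simp add: mult.assoc)
  qed
  moreover have "S 0 = 0" "S \<epsilon> = 0"
    using sin_int_2pin[of "int \<kappa>"] by (simp_all add: S_def \<omega>(2))
  moreover have "continuous_on {0..\<epsilon>} (?u 2)"
    unfolding u by (intro continuous_intros)
  ultimately have "wint ?u (replicate a 1 @ 2 # replicate (N - a) 1) (\<lambda>_. 1) \<epsilon> =
      (-1) ^ a * integral {0..\<epsilon>} (\<lambda>s. ?u 2 s * S s ^ N) / (fact a * fact (N - a))"
    using wint_insert_replicate_closed[of \<epsilon> S ?u 1 2 a "N - a"] assms(1,3) by simp
  also have "(\<lambda>s. ?u 2 s * S s ^ N) = (\<lambda>s. A * c 2 * \<sigma> * (A * c 1 / \<omega>) ^ N *
      (sin (\<omega> * s) ^ N * cos (real N * (\<omega> * s) - real N * pi / 2)))"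
    by (rule ext) (simp only: u S_def power_mult_distrib mult_ac)
  also have "integral {0..\<epsilon>} \<dots> = A * c 2 * \<sigma> * (A * c 1 / \<omega>) ^ N * (\<epsilon> / 2 ^ N)"
    unfolding integral_mult_right using integral_sin_power_mult_cos[OF \<omega>(1) _ \<omega>(2)] assms(1) by simp
  also have "\<dots> = A ^ Suc N * (c 1 ^ N * c 2) * \<sigma> * \<epsilon> / (2 * \<omega>) ^ N"
    by (simp add: power_mult_distrib power_divide mult_ac)
  also have "A ^ Suc N = 1 / \<epsilon> ^ N"
  proof -
    have "A ^ Suc N = \<epsilon> powr (- (real N / real (N + 1)) * real (Suc N))"
      unfolding A_def using assms(1) by (simp only: powr_powr[symmetric] powr_realpow powr_gt_zero)
    also have "- (real N / real (N + 1)) * real (Suc N) = - real N"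
      by simp
    finally show ?thesis
      using assms(1) by (simp add: powr_minus powr_realpow divide_inverse)
  qed
  also have "1 / \<epsilon> ^ N * (c 1 ^ N * c 2) * \<sigma> * \<epsilon> / (2 * \<omega>) ^ N = \<epsilon> * fact N"
  proof -
    have "4 * pi * real \<kappa> = \<epsilon> * (2 * \<omega>)"
      using \<omega>(2) by algebra
    then have "(4 * pi * real \<kappa>) ^ N = \<epsilon> ^ N * (2 * \<omega>) ^ N"
      by (simp only: power_mult_distrib)
    then have "1 / \<epsilon> ^ N * (c 1 ^ N * c 2) * \<sigma> * \<epsilon> / (2 * \<omega>) ^ N = \<epsilon> * fact N * (\<sigma> * \<sigma>)"
      unfolding c \<sigma>_def[symmetric] using assms(1) \<omega>(1) by (simp add: field_simps)
    then show ?thesis by (simp only: \<sigma> mult_1_right)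
  qed
  finally show ?thesis
    using binomial_fact[OF assms(3), where 'a = real] by simp
qed

text \<open>List positions count from 0, so the innermost of the \<open>N + 2\<close> times sits at
  \<open>N + 1\<close>.\<close>

lemma nested_integral_eq_wint_length:
  "nested_integral (N + 2)
      (\<lambda>ss. G (ss ! (N + 1)) * (\<Prod>i<N + 2. u (ks ! i) (ss ! i))) t = wint u ks G t"
  if "length ks = N + 2"
proof -
  have "nested_integral (N + 2)
      (\<lambda>ss. G (ss ! (N + 1)) * (\<Prod>i<N + 2. u (ks ! i) (ss ! i))) t =
    nested_integral (length ks)
      (\<lambda>ss. G (last (t # ss)) * (\<Prod>i<length ks. u (ks ! i) (ss ! i))) t"
    unfolding that
  proof (rule nested_integral_cong)
    fix ss :: "real list" assume "length ss = N + 2"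
    then have "last (t # ss) = ss ! (N + 1)"
      by (cases "ss = []") (auto simp: last_conv_nth)
    then show "G (ss ! (N + 1)) * (\<Prod>i<N + 2. u (ks ! i) (ss ! i)) =
        G (last (t # ss)) * (\<Prod>i<N + 2. u (ks ! i) (ss ! i))"
      by (simp only:)
  qed
  then show ?thesis by (simp only: nested_integral_eq_wint)
qed

section \<open>Evaluation of the expansion for the two inputs\<close>

theorem theorem1:
  fixes D :: "real set" and J :: "real \<Rightarrow> real" and g :: "nat \<Rightarrow> real \<Rightarrow> real"
    and f :: "nat \<Rightarrow> real \<Rightarrow> real" and c :: "nat \<Rightarrow> real"
    and u :: "nat \<Rightarrow> real \<Rightarrow> real" and N \<kappa> :: nat
    and \<epsilon> x0 :: real and x :: "real \<Rightarrow> real"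
  assumes "open D"
    and "N \<ge> 1"
    and f_def: "\<And>k. f k = g k \<circ> J"
    and "Ck_on (N + 1) D (f 1)" and "Ck_on (N + 1) D (f 2)"
    and "\<kappa> \<ge> 1"
    and "c 1 ^ N * c 2 = (4 * pi * real \<kappa>) ^ N * fact N * (-1) ^ (N div 2)"
    and "\<epsilon> > 0"
    and u_def: "u = control N \<kappa> c \<epsilon>"
    and "x0 \<in> D"
    and "\<And>t. t \<in> {0..\<epsilon>} \<Longrightarrow> x t \<in> D"
    and "\<And>t. t \<in> {0..\<epsilon>} \<Longrightarrow>
           (x has_real_derivative g 1 (J (x t)) * u 1 t + g 2 (J (x t)) * u 2 t)
             (at t within {0..\<epsilon>})"
    and "x 0 = x0"
  shows "x \<epsilon> = x0 + \<epsilon> * ad_pow N (f 1) (f 2) x0 + chen_fliess_remainder N f u x \<epsilon>"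
proof -
  let ?words = "\<lambda>m. {ks. set ks \<subseteq> {1, 2 :: nat} \<and> length ks = m}"
  \<comment> \<open>Lie derivatives of the identity along the trajectory; the empty word gives
    \<open>x\<close> itself.\<close>
  define \<phi> where "\<phi> ks = (\<lambda>t. lie_fold f ks (\<lambda>x. x) (x t))" for ks
  define F where "F m = (\<Sum>ks\<in>?words m. \<phi> ks 0 * wint u ks (\<lambda>_. 1) \<epsilon>)" for m
  have fC: "Ck_on (N + 1) D (f k)" if "k \<in> {1, 2}" for k
    using that assms(4,5) by blast
  have u_cont: "continuous_on {0..\<epsilon>} (u k)" for k
    unfolding u_def control_def dither_def using \<open>\<epsilon> > 0\<close>
    by (cases "k = 1"; cases "odd N") (auto intro!: continuous_intros)
  have x': "(x has_real_derivative f 1 (x t) * u 1 t + f 2 (x t) * u 2 t) (at t within {0..\<epsilon>})"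
    if "t \<in> {0..\<epsilon>}" for t
    using assms(12)[OF that] by (simp only: f_def o_apply)
  \<comment> \<open>Each letter costs one derivative: shorter words are still differentiable, while
    for the remainder words of length \<open>N + 2\<close> exactly continuity is left.\<close>
  have foldC: "Ck_on (N + 2 - length ks) D (lie_fold f ks (\<lambda>x. x))"
    if "set ks \<subseteq> {1, 2}" "length ks \<le> N + 2" for ks
    by (rule Ck_on_lie_fold[OF \<open>open D\<close> fC Ck_on_ident]) (use that in auto)
  have "\<phi> [] \<epsilon> = (\<Sum>m<N + 2. F m) + (\<Sum>ks\<in>?words (N + 2). wint u ks (\<phi> ks) \<epsilon>)"
    unfolding F_def
  proof (rule chen_fliess_expansion)
    fix ks assume ks: "set ks \<subseteq> {1, 2 :: nat}" "length ks \<le> N + 2"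
    have "continuous_on {0..\<epsilon>} x"
      by (rule DERIV_continuous_on[OF x'])
    then show "continuous_on {0..\<epsilon>} (\<phi> ks)"
      unfolding \<phi>_def
      by (rule continuous_on_compose2[OF Ck_on_imp_continuous_on[OF foldC[OF ks]]])
        (use assms(11) in blast)
  next
    fix ks s assume ks: "set ks \<subseteq> {1, 2 :: nat}" "length ks < N + 2" and s: "s \<in> {0..\<epsilon>}"
    let ?h = "lie_fold f ks (\<lambda>x. x)"
    have "(?h has_real_derivative deriv ?h (x s)) (at (x s))"
      using ks by (intro Ck_on_imp_DERIV[OF foldC _ assms(11)[OF s]]) auto
    from DERIV_chain2[OF this x'[OF s]]
    show "(\<phi> ks has_real_derivative (\<Sum>k\<in>{1, 2}. u k s * \<phi> (ks @ [k]) s)) (at s within {0..\<epsilon>})"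
      unfolding \<phi>_def lie_fold_snoc lie_deriv_def by (rule DERIV_cong) (simp add: algebra_simps)
  qed (use u_cont \<open>\<epsilon> > 0\<close> in auto)
  moreover have "(\<Sum>ks\<in>?words (N + 2). wint u ks (\<phi> ks) \<epsilon>) = chen_fliess_remainder N f u x \<epsilon>"
    unfolding chen_fliess_remainder_def
  proof (rule sum.cong[OF refl])
    fix ks assume "ks \<in> ?words (N + 2)"
    then have len: "length ks = N + 2" and "ks \<noteq> []" by auto
    have "\<phi> ks = (\<lambda>s. lie_word f ks (x s))"
      by (simp only: \<phi>_def lie_word_eq_lie_fold[OF \<open>ks \<noteq> []\<close>])
    then show "wint u ks (\<phi> ks) \<epsilon> = nested_integral (N + 2)
        (\<lambda>ss. lie_word f ks (x (ss ! (N + 1))) * (\<Prod>i<N + 2. u (ks ! i) (ss ! i))) \<epsilon>"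
      using nested_integral_eq_wint_length[OF len, of "\<phi> ks" u \<epsilon>] by simp
  qed
  moreover have "(\<Sum>m<N + 2. F m) = x0 + \<epsilon> * ad_pow N (f 1) (f 2) x0"
  proof -
    define \<omega> where "\<omega> = 2 * pi * real \<kappa> / \<epsilon>"
    \<comment> \<open>Amplitudes in the form expected by \<open>wint_period_eq_0\<close>, with the
      sign of the second input absorbed.\<close>
    define \<alpha> where "\<alpha> k = \<epsilon> powr (- (real N / real (N + 1))) *
      (if k = 1 then c 1 else c 2 * (-1) ^ (N div 2))" for k :: nat
    have \<omega>: "\<omega> > 0" "\<omega> * \<epsilon> = 2 * pi * real \<kappa>"
      using assms(6,8) by (simp_all add: \<omega>_def)
    have u: "u 1 s = \<alpha> 1 * cos (\<omega> * s)"
      "u 2 s = \<alpha> 2 * cos (real N * (\<omega> * s) - real N * pi / 2)" for s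
      using control_eq[OF \<open>\<epsilon> > 0\<close>, of N \<kappa> c s] by (simp_all add: u_def \<alpha>_def \<omega>_def)
    \<comment> \<open>A word of length at most \<open>N\<close> with a letter 2 has fewer than
      \<open>N\<close> letters 1; at length \<open>N + 1\<close> the same holds if there are at
      least two letters 2. Words without 2 fall under the other alternative of
      \<open>wint_period_eq_0\<close>.\<close>
    have vanish: "wint u ks (\<lambda>_. 1) \<epsilon> = 0"
      if "set ks \<subseteq> {1, 2}" "ks \<noteq> []" "length ks \<le> N \<or> length ks = Suc N \<and> count_list ks 2 \<noteq> 1" for ks
    proof (rule wint_period_eq_0[OF \<omega> u])
      show "count_list ks 1 < N \<or> count_list ks 2 = 0"
        using count_list_two_letters[of 1 "2 :: nat" ks] that by auto
    qed (use that in auto)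
    have "?words 0 = {[]}" by auto
    then have "F 0 = x0"
      using assms(13) by (simp add: F_def \<phi>_def)
    moreover have "F (Suc m) = 0" if "m < N" for m
      unfolding F_def by (rule sum.neutral) (use that in \<open>auto intro!: vanish\<close>)
    moreover have "F (Suc N) = \<epsilon> * ad_pow N (f 1) (f 2) x0"
    proof -
      let ?w = "\<lambda>a. replicate a 1 @ 2 # replicate (N - a) (1 :: nat)"
      have "F (Suc N) = (\<Sum>ks | set ks \<subseteq> {1, 2} \<and> length ks = Suc N \<and> count_list ks 2 = 1.
          \<phi> ks 0 * wint u ks (\<lambda>_. 1) \<epsilon>)"
        unfolding F_def
      proof (rule sum.mono_neutral_right)
        show "\<forall>ks \<in> ?words (Suc N) - {ks. set ks \<subseteq> {1, 2} \<and> length ks = Suc N \<and> count_list ks 2 = 1}.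
            \<phi> ks 0 * wint u ks (\<lambda>_. 1) \<epsilon> = 0"
        proof
          fix ks assume "ks \<in> ?words (Suc N) -
            {ks. set ks \<subseteq> {1, 2} \<and> length ks = Suc N \<and> count_list ks 2 = 1}"
          then have "wint u ks (\<lambda>_. 1) \<epsilon> = 0" by (intro vanish) auto
          then show "\<phi> ks 0 * wint u ks (\<lambda>_. 1) \<epsilon> = 0" by simp
        qed
      qed (auto simp: finite_lists_length_eq)
      also have "\<dots> = (\<Sum>a\<le>N. \<phi> (?w a) 0 * wint u (?w a) (\<lambda>_. 1) \<epsilon>)"
        by (subst lists_with_one_occurrence) (simp_all add: sum.reindex inj_on_insert_replicate)
      also have "\<dots> = (\<Sum>a\<le>N. \<epsilon> * ((-1) ^ a * real (N choose a) * \<phi> (?w a) 0))"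
      proof (rule sum.cong[OF refl])
        fix a assume "a \<in> {..N}"
        then have "wint u (?w a) (\<lambda>_. 1) \<epsilon> = \<epsilon> * ((-1) ^ a * real (N choose a))"
          unfolding u_def by (intro wint_control_insert assms(6-8)) simp
        then show "\<phi> (?w a) 0 * wint u (?w a) (\<lambda>_. 1) \<epsilon> = \<epsilon> * ((-1) ^ a * real (N choose a) * \<phi> (?w a) 0)"
          by simp
      qed
      \<comment> \<open>The sum is the expansion of the bracket operator applied to the identity,
        which returns the bracket itself.\<close>
      also have "\<dots> = \<epsilon> * lie_deriv (ad_pow N (f 1) (f 2)) (\<lambda>x. x) x0"
        using assms(4,5) ad_pow_expansion[OF \<open>open D\<close> _ _ order_refl Ck_on_ident \<open>x0 \<in> D\<close>, of N f 1 2]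
        by (simp add: sum_distrib_left \<phi>_def assms(13))
      finally show ?thesis
        by (simp add: lie_deriv_def)
    qed
    moreover have "(\<Sum>m<N + 2. F m) = F 0 + ((\<Sum>m<N. F (Suc m)) + F (Suc N))"
      using sum.lessThan_Suc_shift[of F "Suc N"] by simp
    ultimately show ?thesis by simp
  qed
  ultimately show ?thesis
    by (simp add: \<phi>_def)
qed

end
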